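(* Let $R$ be a ring, $\sigma$ an endomorphism of $R$, $\delta$ a $\sigma$-derivation of $R$, and $M_R$ a right $R$-module. (1) If $M_R$ is completely $(\sigma,\delta)$-compatible, then $M_R$ is $(\sigma,\delta)$-compatible. (2) If $M_R$ is completely $(\sigma,\delta)$-compatible, then $(M/N)_R$ is completely $(\sigma,\delta)$-compatible for every submodule $N_R$ of $M_R$.
   Context: Rings are associative with identity, not necessarily commutative; modules are right modules. A $\sigma$-derivation of $R$ is an additive map $\delta:R\to R$ with $\delta(rs)=\sigma(r)\delta(s)+\delta(r)s$ for all $r,s\in R$. A right module $L_R$ is $\sigma$-compatible if for all $m\in L$, $r\in R$: $mr=0$ if and only if $m\sigma(r)=0$; it is $\delta$-compatible if $mr=0$ implies $m\delta(r)=0$ for all $m\in L$, $r\in R$; it is $(\sigma,\delta)$-compatible if it is both. $L_R$ is completely $\sigma$-compatible (resp. completely $\delta$-compatible) if $(L/N)_R$ is $\sigma$-compatible (resp. $\delta$-compatible) for every submodule $N_R$ of $L_R$; it is completely $(\sigma,\delta)$-compatible if it is both. *)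

theory Defs
  imports "HOL-Algebra.Ideal"
begin

text \<open>
  \<open>HOL-Algebra.Module\<close> only treats left modules over commutative rings. As in that theory, a
  module extends the record of rings, whose fields \<open>mult\<close> and \<open>one\<close> are not used.
\<close>

record ('a, 'b) right_module = "'b ring" +
  rsmult :: "['b, 'a] \<Rightarrow> 'b" (infixl \<open>\<cdot>\<index>\<close> 70)

locale right_module = R?: ring R + M?: abelian_group M
  for R :: "('a, 'r) ring_scheme" (structure)
    and M :: "('a, 'b, 'm) right_module_scheme" (structure) +
  assumes rsmult_closed [simp, intro]:
      "\<lbrakk>m \<in> carrier M; r \<in> carrier R\<rbrakk> \<Longrightarrow> m \<cdot>\<^bsub>M\<^esub> r \<in> carrier M"
    and rsmult_add_left:
      "\<lbrakk>m \<in> carrier M; n \<in> carrier M; r \<in> carrier R\<rbrakk> \<Longrightarrow>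
        (m \<oplus>\<^bsub>M\<^esub> n) \<cdot>\<^bsub>M\<^esub> r = (m \<cdot>\<^bsub>M\<^esub> r) \<oplus>\<^bsub>M\<^esub> (n \<cdot>\<^bsub>M\<^esub> r)"
    and rsmult_add_right:
      "\<lbrakk>m \<in> carrier M; r \<in> carrier R; s \<in> carrier R\<rbrakk> \<Longrightarrow>
        m \<cdot>\<^bsub>M\<^esub> (r \<oplus>\<^bsub>R\<^esub> s) = (m \<cdot>\<^bsub>M\<^esub> r) \<oplus>\<^bsub>M\<^esub> (m \<cdot>\<^bsub>M\<^esub> s)"
    and rsmult_assoc:
      "\<lbrakk>m \<in> carrier M; r \<in> carrier R; s \<in> carrier R\<rbrakk> \<Longrightarrow>
        m \<cdot>\<^bsub>M\<^esub> (r \<otimes>\<^bsub>R\<^esub> s) = (m \<cdot>\<^bsub>M\<^esub> r) \<cdot>\<^bsub>M\<^esub> s"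
    and rsmult_one [simp]:
      "m \<in> carrier M \<Longrightarrow> m \<cdot>\<^bsub>M\<^esub> \<one>\<^bsub>R\<^esub> = m"

definition right_submodule ::
    "['b set, ('a, 'r) ring_scheme, ('a, 'b, 'm) right_module_scheme] \<Rightarrow> bool" where
  "right_submodule N R M \<longleftrightarrow>
     additive_subgroup N M \<and> (\<forall>n\<in>N. \<forall>r\<in>carrier R. n \<cdot>\<^bsub>M\<^esub> r \<in> N)"

text \<open>
  The elements of \<open>M/N\<close> are the cosets \<open>N + m\<close>. The scalar multiplication takes a union over
  all representatives of the coset, as \<open>rcoset_mult\<close> does for quotient rings; see
  \<open>rsmult_quotient\<close> below.
\<close>

definition quotient_module ::
    "[('a, 'b, 'm) right_module_scheme, 'b set] \<Rightarrow> ('a, 'b set) right_module" where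
  "quotient_module M N =
     \<lparr>carrier = a_rcosets\<^bsub>M\<^esub> N, mult = undefined, one = undefined,
      zero = N, add = set_add M,
      rsmult = (\<lambda>X r. \<Union>x\<in>X. N +>\<^bsub>M\<^esub> (x \<cdot>\<^bsub>M\<^esub> r))\<rparr>"

definition sigma_derivation ::
    "[('a, 'r) ring_scheme, 'a \<Rightarrow> 'a, 'a \<Rightarrow> 'a] \<Rightarrow> bool" where
  "sigma_derivation R \<sigma> \<delta> \<longleftrightarrow>
     \<delta> \<in> carrier R \<rightarrow> carrier R \<and>
     (\<forall>r\<in>carrier R. \<forall>s\<in>carrier R. \<delta> (r \<oplus>\<^bsub>R\<^esub> s) = \<delta> r \<oplus>\<^bsub>R\<^esub> \<delta> s) \<and>
     (\<forall>r\<in>carrier R. \<forall>s\<in>carrier R.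
        \<delta> (r \<otimes>\<^bsub>R\<^esub> s) = (\<sigma> r \<otimes>\<^bsub>R\<^esub> \<delta> s) \<oplus>\<^bsub>R\<^esub> (\<delta> r \<otimes>\<^bsub>R\<^esub> s))"

definition sigma_compatible ::
    "[('a, 'r) ring_scheme, 'a \<Rightarrow> 'a, ('a, 'b, 'm) right_module_scheme] \<Rightarrow> bool" where
  "sigma_compatible R \<sigma> L \<longleftrightarrow>
     (\<forall>m\<in>carrier L. \<forall>r\<in>carrier R. m \<cdot>\<^bsub>L\<^esub> r = \<zero>\<^bsub>L\<^esub> \<longleftrightarrow> m \<cdot>\<^bsub>L\<^esub> \<sigma> r = \<zero>\<^bsub>L\<^esub>)"

definition delta_compatible ::
    "[('a, 'r) ring_scheme, 'a \<Rightarrow> 'a, ('a, 'b, 'm) right_module_scheme] \<Rightarrow> bool" where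
  "delta_compatible R \<delta> L \<longleftrightarrow>
     (\<forall>m\<in>carrier L. \<forall>r\<in>carrier R. m \<cdot>\<^bsub>L\<^esub> r = \<zero>\<^bsub>L\<^esub> \<longrightarrow> m \<cdot>\<^bsub>L\<^esub> \<delta> r = \<zero>\<^bsub>L\<^esub>)"

definition sigma_delta_compatible ::
    "[('a, 'r) ring_scheme, 'a \<Rightarrow> 'a, 'a \<Rightarrow> 'a, ('a, 'b, 'm) right_module_scheme] \<Rightarrow> bool" where
  "sigma_delta_compatible R \<sigma> \<delta> L \<longleftrightarrow> sigma_compatible R \<sigma> L \<and> delta_compatible R \<delta> L"

definition completely_sigma_compatible ::
    "[('a, 'r) ring_scheme, 'a \<Rightarrow> 'a, ('a, 'b, 'm) right_module_scheme] \<Rightarrow> bool" where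
  "completely_sigma_compatible R \<sigma> L \<longleftrightarrow>
     (\<forall>N. right_submodule N R L \<longrightarrow> sigma_compatible R \<sigma> (quotient_module L N))"

definition completely_delta_compatible ::
    "[('a, 'r) ring_scheme, 'a \<Rightarrow> 'a, ('a, 'b, 'm) right_module_scheme] \<Rightarrow> bool" where
  "completely_delta_compatible R \<delta> L \<longleftrightarrow>
     (\<forall>N. right_submodule N R L \<longrightarrow> delta_compatible R \<delta> (quotient_module L N))"

definition completely_sigma_delta_compatible ::
    "[('a, 'r) ring_scheme, 'a \<Rightarrow> 'a, 'a \<Rightarrow> 'a, ('a, 'b, 'm) right_module_scheme] \<Rightarrow> bool" where
  "completely_sigma_delta_compatible R \<sigma> \<delta> L \<longleftrightarrow>
     completely_sigma_compatible R \<sigma> L \<and> completely_delta_compatible R \<delta> L"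

context right_module
begin

lemma right_submodule_abelian_subgroup:
  assumes "right_submodule N R M"
  shows "abelian_subgroup N M"
  using assms M.abelian_group_axioms unfolding right_submodule_def
  by (blast intro: abelian_subgroupI3)

lemma rsmult_quotient:
  assumes N: "right_submodule N R M" and m: "m \<in> carrier M" and r: "r \<in> carrier R"
  shows "(N +>\<^bsub>M\<^esub> m) \<cdot>\<^bsub>quotient_module M N\<^esub> r = N +>\<^bsub>M\<^esub> (m \<cdot>\<^bsub>M\<^esub> r)"
proof -
  interpret N: abelian_subgroup N M
    using N by (rule right_submodule_abelian_subgroup)
  have "N +>\<^bsub>M\<^esub> (x \<cdot>\<^bsub>M\<^esub> r) = N +>\<^bsub>M\<^esub> (m \<cdot>\<^bsub>M\<^esub> r)" if x: "x \<in> N +>\<^bsub>M\<^esub> m" for x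
  proof -
    obtain n where n: "n \<in> N" "x = n \<oplus>\<^bsub>M\<^esub> m"
      using x by (auto simp: a_r_coset_def')
    have nr: "n \<cdot>\<^bsub>M\<^esub> r \<in> N"
      using N n r by (auto simp: right_submodule_def)
    have "x \<cdot>\<^bsub>M\<^esub> r = (n \<cdot>\<^bsub>M\<^esub> r) \<oplus>\<^bsub>M\<^esub> (m \<cdot>\<^bsub>M\<^esub> r)"
      using n m r by (simp add: rsmult_add_left)
    then have "x \<cdot>\<^bsub>M\<^esub> r \<in> N +>\<^bsub>M\<^esub> (m \<cdot>\<^bsub>M\<^esub> r)"
      using nr by (auto simp: a_r_coset_def')
    then show ?thesis
      using N.a_repr_independence'[OF _ rsmult_closed[OF m r]] by simp
  qed
  then have "(\<Union>x\<in>N +>\<^bsub>M\<^esub> m. N +>\<^bsub>M\<^esub> (x \<cdot>\<^bsub>M\<^esub> r)) = N +>\<^bsub>M\<^esub> (m \<cdot>\<^bsub>M\<^esub> r)"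
    by (intro SUP_eq_const) (use N.a_rcos_self[OF m] in blast)+
  then show ?thesis
    by (simp add: quotient_module_def)
qed

lemma quotient_right_module:
  assumes N: "right_submodule N R M"
  shows "right_module R (quotient_module M N)"
proof -
  interpret N: abelian_subgroup N M
    using N by (rule right_submodule_abelian_subgroup)
  let ?Q = "quotient_module M N"
  have carr: "carrier ?Q = {N +>\<^bsub>M\<^esub> m | m. m \<in> carrier M}"
    by (auto simp: quotient_module_def A_RCOSETS_def')
  have add: "(N +>\<^bsub>M\<^esub> m) \<oplus>\<^bsub>?Q\<^esub> (N +>\<^bsub>M\<^esub> n) = N +>\<^bsub>M\<^esub> (m \<oplus>\<^bsub>M\<^esub> n)"
    if "m \<in> carrier M" "n \<in> carrier M" for m n
    using that by (simp add: quotient_module_def N.a_rcos_sum)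
  have zero: "\<zero>\<^bsub>?Q\<^esub> = N +>\<^bsub>M\<^esub> \<zero>\<^bsub>M\<^esub>"
    using M.a_coset_add_zero[OF N.a_subset] by (simp add: quotient_module_def)
  have inv: "\<exists>Y\<in>carrier ?Q. Y \<oplus>\<^bsub>?Q\<^esub> X = \<zero>\<^bsub>?Q\<^esub>" if X: "X \<in> carrier ?Q" for X
  proof -
    obtain m where m: "m \<in> carrier M" "X = N +>\<^bsub>M\<^esub> m"
      using X unfolding carr by blast
    show ?thesis
    proof (rule bexI)
      show "(N +>\<^bsub>M\<^esub> (\<ominus>\<^bsub>M\<^esub> m)) \<oplus>\<^bsub>?Q\<^esub> X = \<zero>\<^bsub>?Q\<^esub>"
        using m by (simp add: add zero M.l_neg)
      show "N +>\<^bsub>M\<^esub> (\<ominus>\<^bsub>M\<^esub> m) \<in> carrier ?Q"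
        using m unfolding carr by blast
    qed
  qed
  have "abelian_group ?Q"
  proof (rule abelian_groupI)
    show "\<And>X. X \<in> carrier ?Q \<Longrightarrow> \<exists>Y\<in>carrier ?Q. Y \<oplus>\<^bsub>?Q\<^esub> X = \<zero>\<^bsub>?Q\<^esub>"
      by (rule inv)
    show "\<zero>\<^bsub>?Q\<^esub> \<in> carrier ?Q"
      unfolding carr zero by blast
    show "\<And>X Y. \<lbrakk>X \<in> carrier ?Q; Y \<in> carrier ?Q\<rbrakk> \<Longrightarrow> X \<oplus>\<^bsub>?Q\<^esub> Y \<in> carrier ?Q"
      unfolding carr by (auto simp: add)
  qed (auto simp: carr add zero M.a_ac)
  show ?thesis
  proof (intro right_module.intro right_module_axioms.intro R.ring_axioms \<open>abelian_group ?Q\<close>)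
    show "\<And>X r. \<lbrakk>X \<in> carrier ?Q; r \<in> carrier R\<rbrakk> \<Longrightarrow> X \<cdot>\<^bsub>?Q\<^esub> r \<in> carrier ?Q"
      unfolding carr using rsmult_quotient[OF N] by auto
    fix X r s assume "X \<in> carrier ?Q" and r: "r \<in> carrier R" and s: "s \<in> carrier R"
    then obtain m where m: "m \<in> carrier M" "X = N +>\<^bsub>M\<^esub> m"
      unfolding carr by blast
    show "X \<cdot>\<^bsub>?Q\<^esub> (r \<oplus>\<^bsub>R\<^esub> s) = (X \<cdot>\<^bsub>?Q\<^esub> r) \<oplus>\<^bsub>?Q\<^esub> (X \<cdot>\<^bsub>?Q\<^esub> s)"
      using m r s by (simp add: add rsmult_quotient[OF N] rsmult_add_right)
    show "X \<cdot>\<^bsub>?Q\<^esub> (r \<otimes>\<^bsub>R\<^esub> s) = (X \<cdot>\<^bsub>?Q\<^esub> r) \<cdot>\<^bsub>?Q\<^esub> s"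
      using m r s by (simp add: rsmult_quotient[OF N] rsmult_assoc)
  next
    fix X Y r assume "X \<in> carrier ?Q" "Y \<in> carrier ?Q" and r: "r \<in> carrier R"
    then obtain m n where m: "m \<in> carrier M" "X = N +>\<^bsub>M\<^esub> m"
        and n: "n \<in> carrier M" "Y = N +>\<^bsub>M\<^esub> n"
      unfolding carr by blast
    show "(X \<oplus>\<^bsub>?Q\<^esub> Y) \<cdot>\<^bsub>?Q\<^esub> r = (X \<cdot>\<^bsub>?Q\<^esub> r) \<oplus>\<^bsub>?Q\<^esub> (Y \<cdot>\<^bsub>?Q\<^esub> r)"
      using m n r by (simp add: add rsmult_quotient[OF N] rsmult_add_left)
  next
    fix X assume "X \<in> carrier ?Q"
    then obtain m where m: "m \<in> carrier M" "X = N +>\<^bsub>M\<^esub> m"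
      unfolding carr by blast
    show "X \<cdot>\<^bsub>?Q\<^esub> \<one>\<^bsub>R\<^esub> = X"
      using m by (simp add: rsmult_quotient[OF N])
  qed
qed

end

end

theory Submission
  imports Defs
begin

text \<open>
  Compatibility of \<open>M/N\<close> says that \<open>m \<cdot> r \<in> N\<close> is equivalent to \<open>m \<cdot> \<sigma> r \<in> N\<close> and implies
  \<open>m \<cdot> \<delta> r \<in> N\<close>. The choice \<open>N = 0\<close> gives (1). For (2), the condition on \<open>(M/N)/P\<close> is
  the condition on \<open>M/P'\<close>, where \<open>P'\<close> is the preimage of \<open>P\<close> in \<open>M\<close>.
\<close>

context right_module
begin

lemma rsmult_zero_left:
  assumes "r \<in> carrier R"
  shows "\<zero>\<^bsub>M\<^esub> \<cdot>\<^bsub>M\<^esub> r = \<zero>\<^bsub>M\<^esub>"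
proof -
  have "(\<zero>\<^bsub>M\<^esub> \<cdot>\<^bsub>M\<^esub> r) \<oplus>\<^bsub>M\<^esub> (\<zero>\<^bsub>M\<^esub> \<cdot>\<^bsub>M\<^esub> r) = \<zero>\<^bsub>M\<^esub> \<cdot>\<^bsub>M\<^esub> r"
    using rsmult_add_left[of "\<zero>\<^bsub>M\<^esub>" "\<zero>\<^bsub>M\<^esub>" r] assms by simp
  then show ?thesis
    using assms M.add.r_cancel_one' by (metis M.zero_closed rsmult_closed)
qed

lemma right_submodule_zero: "right_submodule {\<zero>\<^bsub>M\<^esub>} R M"
  unfolding right_submodule_def additive_subgroup_def
  using M.add.one_in_subset M.add.triv_subgroup by (auto simp: rsmult_zero_left)

text \<open>Closure under negatives comes from closure under scalars, because the negative of
  \<open>n\<close> is \<open>n\<close> times minus one.\<close>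

lemma right_submoduleI:
  assumes "N \<subseteq> carrier M" "\<zero>\<^bsub>M\<^esub> \<in> N"
    and "\<And>m n. m \<in> N \<Longrightarrow> n \<in> N \<Longrightarrow> m \<oplus>\<^bsub>M\<^esub> n \<in> N"
    and smult: "\<And>n r. n \<in> N \<Longrightarrow> r \<in> carrier R \<Longrightarrow> n \<cdot>\<^bsub>M\<^esub> r \<in> N"
  shows "right_submodule N R M"
proof -
  have minus: "\<ominus>\<^bsub>M\<^esub> n \<in> N" if n: "n \<in> N" for n
  proof -
    have nM: "n \<in> carrier M" using n assms(1) by blast
    have "(n \<cdot>\<^bsub>M\<^esub> (\<ominus>\<^bsub>R\<^esub> \<one>\<^bsub>R\<^esub>)) \<oplus>\<^bsub>M\<^esub> n = n \<cdot>\<^bsub>M\<^esub> (\<ominus>\<^bsub>R\<^esub> \<one>\<^bsub>R\<^esub> \<oplus>\<^bsub>R\<^esub> \<one>\<^bsub>R\<^esub>)"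
      using nM by (simp add: rsmult_add_right)
    also have "\<dots> = n \<cdot>\<^bsub>M\<^esub> \<zero>\<^bsub>R\<^esub>"
      by (simp add: R.l_neg)
    \<comment> \<open>Since 0 + 0 = 0 in \<open>R\<close>, the element \<open>n\<close> times 0
      equals its own double, so cancellation makes it zero.\<close>
    also have "\<dots> = \<zero>\<^bsub>M\<^esub>"
      using rsmult_add_right[of n "\<zero>\<^bsub>R\<^esub>" "\<zero>\<^bsub>R\<^esub>"] nM
      by (metis M.add.r_cancel_one' R.l_zero R.zero_closed rsmult_closed)
    finally have "\<ominus>\<^bsub>M\<^esub> n = n \<cdot>\<^bsub>M\<^esub> (\<ominus>\<^bsub>R\<^esub> \<one>\<^bsub>R\<^esub>)"
      using nM by (intro M.minus_equality) auto
    then show ?thesis using smult[OF n] by simp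
  qed
  have "subgroup N (add_monoid M)"
    using assms minus by (intro M.add.subgroupI) (auto simp: a_inv_def)
  then show ?thesis
    using smult by (auto simp: right_submodule_def additive_subgroup_def)
qed

lemma carrier_quotient_module:
  "carrier (quotient_module M N) = (\<lambda>m. N +>\<^bsub>M\<^esub> m) ` carrier M"
  by (auto simp: quotient_module_def A_RCOSETS_def')

lemma add_quotient_module:
  assumes "right_submodule N R M" "m \<in> carrier M" "n \<in> carrier M"
  shows "(N +>\<^bsub>M\<^esub> m) \<oplus>\<^bsub>quotient_module M N\<^esub> (N +>\<^bsub>M\<^esub> n) = N +>\<^bsub>M\<^esub> (m \<oplus>\<^bsub>M\<^esub> n)"
proof -
  interpret N: abelian_subgroup N M
    using assms(1) by (rule right_submodule_abelian_subgroup)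
  show ?thesis
    using assms by (simp add: quotient_module_def N.a_rcos_sum)
qed

text \<open>The zero of the quotient is the set \<open>N\<close> itself. As \<open>m\<close> lies in
  its own coset, a coset equal to \<open>N\<close> puts \<open>m\<close> in \<open>N\<close>;
  conversely, an element of \<open>N\<close> has coset \<open>N\<close>.\<close>

lemma coset_eq_zero_iff:
  assumes "right_submodule N R M" "m \<in> carrier M"
  shows "N +>\<^bsub>M\<^esub> m = \<zero>\<^bsub>quotient_module M N\<^esub> \<longleftrightarrow> m \<in> N"
proof -
  interpret N: abelian_subgroup N M
    using assms(1) by (rule right_submodule_abelian_subgroup)
  show ?thesis
    using assms(2) N.a_rcos_self[of m] N.a_rcos_const[of m]
    by (auto simp: quotient_module_def)
qed

text \<open>Every element of the quotient is a coset of some \<open>m\<close>, and its product with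
  \<open>r\<close> is the coset of \<open>m\<close> times \<open>r\<close>, which vanishes exactly
  when that product lies in \<open>N\<close>. Cosets thus disappear from the condition.\<close>

lemma sigma_compatible_quotient_iff:
  assumes "right_submodule N R M" "\<sigma> \<in> carrier R \<rightarrow> carrier R"
  shows "sigma_compatible R \<sigma> (quotient_module M N) \<longleftrightarrow>
    (\<forall>m\<in>carrier M. \<forall>r\<in>carrier R. m \<cdot>\<^bsub>M\<^esub> r \<in> N \<longleftrightarrow> m \<cdot>\<^bsub>M\<^esub> \<sigma> r \<in> N)"
  using funcset_mem[OF assms(2)] unfolding sigma_compatible_def
  by (simp add: carrier_quotient_module rsmult_quotient[OF assms(1)]
      coset_eq_zero_iff[OF assms(1)])

lemma delta_compatible_quotient_iff:
  assumes "right_submodule N R M" "\<delta> \<in> carrier R \<rightarrow> carrier R"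
  shows "delta_compatible R \<delta> (quotient_module M N) \<longleftrightarrow>
    (\<forall>m\<in>carrier M. \<forall>r\<in>carrier R. m \<cdot>\<^bsub>M\<^esub> r \<in> N \<longrightarrow> m \<cdot>\<^bsub>M\<^esub> \<delta> r \<in> N)"
  using funcset_mem[OF assms(2)] unfolding delta_compatible_def
  by (simp add: carrier_quotient_module rsmult_quotient[OF assms(1)]
      coset_eq_zero_iff[OF assms(1)])

text \<open>For the zero submodule, membership in \<open>N\<close> means vanishing in
  \<open>M\<close>, so the criterion gives the claim without passing through an isomorphism of
  \<open>M/0\<close> with \<open>M\<close>.\<close>

lemma completely_sigma_compatible_imp_sigma_compatible:
  assumes "completely_sigma_compatible R \<sigma> M" "\<sigma> \<in> carrier R \<rightarrow> carrier R"
  shows "sigma_compatible R \<sigma> M"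
  using assms sigma_compatible_quotient_iff[OF right_submodule_zero assms(2)] right_submodule_zero
  \<comment> \<open>Unfolding compatibility at \<open>M\<close> only keeps it folded at the
    quotient, where the criterion rewrites it.\<close>
  unfolding completely_sigma_compatible_def sigma_compatible_def[of _ _ M] by simp

lemma completely_delta_compatible_imp_delta_compatible:
  assumes "completely_delta_compatible R \<delta> M" "\<delta> \<in> carrier R \<rightarrow> carrier R"
  shows "delta_compatible R \<delta> M"
  using assms delta_compatible_quotient_iff[OF right_submodule_zero assms(2)] right_submodule_zero
  unfolding completely_delta_compatible_def delta_compatible_def[of _ _ M] by simp

text \<open>The projection from \<open>M\<close> to \<open>M/N\<close> is additive and respects
  scalars, so the closure properties of \<open>P\<close> pull back. The preimage is the submodule of
  \<open>M\<close> at which complete compatibility is later applied.\<close>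

lemma right_submodule_preimage:
  assumes N: "right_submodule N R M" and P: "right_submodule P R (quotient_module M N)"
  shows "right_submodule {m \<in> carrier M. N +>\<^bsub>M\<^esub> m \<in> P} R M"
proof -
  interpret P: additive_subgroup P "quotient_module M N"
    using P by (simp add: right_submodule_def)
  have zero: "N +>\<^bsub>M\<^esub> \<zero>\<^bsub>M\<^esub> = \<zero>\<^bsub>quotient_module M N\<^esub>"
    using right_submodule_abelian_subgroup[OF N]
    by (subst coset_eq_zero_iff[OF N])
      (auto simp: abelian_subgroup_def intro: additive_subgroup.zero_closed)
  have smult: "X \<cdot>\<^bsub>quotient_module M N\<^esub> r \<in> P" if "X \<in> P" "r \<in> carrier R" for X r
    using P that by (simp add: right_submodule_def)
  show ?thesis
  proof (rule right_submoduleI)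
    show "\<zero>\<^bsub>M\<^esub> \<in> {m \<in> carrier M. N +>\<^bsub>M\<^esub> m \<in> P}"
      using P.zero_closed by (simp add: zero)
    show "m \<oplus>\<^bsub>M\<^esub> n \<in> {m \<in> carrier M. N +>\<^bsub>M\<^esub> m \<in> P}"
      if "m \<in> {m \<in> carrier M. N +>\<^bsub>M\<^esub> m \<in> P}" "n \<in> {m \<in> carrier M. N +>\<^bsub>M\<^esub> m \<in> P}" for m n
      \<comment> \<open>The coset of a sum is rewritten backwards into a sum of cosets, to which
        closure of \<open>P\<close> applies.\<close>
      using that P.a_closed by (auto simp flip: add_quotient_module[OF N])
    show "n \<cdot>\<^bsub>M\<^esub> r \<in> {m \<in> carrier M. N +>\<^bsub>M\<^esub> m \<in> P}"
      if "n \<in> {m \<in> carrier M. N +>\<^bsub>M\<^esub> m \<in> P}" "r \<in> carrier R" for n r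
      using that smult by (auto simp flip: rsmult_quotient[OF N])
  qed auto
qed

text \<open>The criteria for \<open>M/P'\<close> and for \<open>(M/N)/P\<close> are the same
  condition on representatives. This comparison stands in for the isomorphism between the two
  quotients.\<close>

lemma completely_sigma_compatible_quotient:
  assumes M: "completely_sigma_compatible R \<sigma> M" and \<sigma>: "\<sigma> \<in> carrier R \<rightarrow> carrier R"
    and N: "right_submodule N R M"
  shows "completely_sigma_compatible R \<sigma> (quotient_module M N)"
  unfolding completely_sigma_compatible_def
proof (intro allI impI)
  fix P assume P: "right_submodule P R (quotient_module M N)"
  \<comment> \<open>With \<open>M/N\<close> as the base module, the same criterion also covers the
    iterated quotient.\<close>
  interpret Q: right_module R "quotient_module M N"
    using N by (rule quotient_right_module)
  note P' = right_submodule_preimage[OF N P]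
  have "\<forall>m\<in>carrier M. \<forall>r\<in>carrier R. N +>\<^bsub>M\<^esub> (m \<cdot>\<^bsub>M\<^esub> r) \<in> P \<longleftrightarrow> N +>\<^bsub>M\<^esub> (m \<cdot>\<^bsub>M\<^esub> \<sigma> r) \<in> P"
    using M P' sigma_compatible_quotient_iff[OF P' \<sigma>] funcset_mem[OF \<sigma>]
    by (simp add: completely_sigma_compatible_def)
  \<comment> \<open>The criterion over \<open>M/N\<close> ranges over cosets of \<open>N\<close>;
    writing each as the coset of some \<open>m\<close> in \<open>M\<close> turns it into the
    condition just obtained.\<close>
  then show "sigma_compatible R \<sigma> (quotient_module (quotient_module M N) P)"
    using funcset_mem[OF \<sigma>] unfolding Q.sigma_compatible_quotient_iff[OF P \<sigma>]
    by (simp add: carrier_quotient_module rsmult_quotient[OF N])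
qed

text \<open>The comparison of \<open>M/P'\<close> with \<open>(M/N)/P\<close> carries over, with an
  implication in place of the equivalence.\<close>

lemma completely_delta_compatible_quotient:
  assumes M: "completely_delta_compatible R \<delta> M" and \<delta>: "\<delta> \<in> carrier R \<rightarrow> carrier R"
    and N: "right_submodule N R M"
  shows "completely_delta_compatible R \<delta> (quotient_module M N)"
  unfolding completely_delta_compatible_def
proof (intro allI impI)
  fix P assume P: "right_submodule P R (quotient_module M N)"
  interpret Q: right_module R "quotient_module M N"
    using N by (rule quotient_right_module)
  note P' = right_submodule_preimage[OF N P]
  have "\<forall>m\<in>carrier M. \<forall>r\<in>carrier R. N +>\<^bsub>M\<^esub> (m \<cdot>\<^bsub>M\<^esub> r) \<in> P \<longrightarrow> N +>\<^bsub>M\<^esub> (m \<cdot>\<^bsub>M\<^esub> \<delta> r) \<in> P"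
    using M P' delta_compatible_quotient_iff[OF P' \<delta>] funcset_mem[OF \<delta>]
    by (simp add: completely_delta_compatible_def)
  then show "delta_compatible R \<delta> (quotient_module (quotient_module M N) P)"
    using funcset_mem[OF \<delta>] unfolding Q.delta_compatible_quotient_iff[OF P \<delta>]
    by (simp add: carrier_quotient_module rsmult_quotient[OF N])
qed

end

theorem proposition3p4:
  fixes R :: "('a, 'r) ring_scheme"
    and M :: "('a, 'b, 'm) right_module_scheme"
    and \<sigma> \<delta> :: "'a \<Rightarrow> 'a"
  assumes "ring R"
    and "\<sigma> \<in> ring_hom R R"
    and "sigma_derivation R \<sigma> \<delta>"
    and "right_module R M"
  shows "(completely_sigma_delta_compatible R \<sigma> \<delta> M \<longrightarrow> sigma_delta_compatible R \<sigma> \<delta> M)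
    \<and> (completely_sigma_delta_compatible R \<sigma> \<delta> M \<longrightarrow>
        (\<forall>N. right_submodule N R M \<longrightarrow>
          completely_sigma_delta_compatible R \<sigma> \<delta> (quotient_module M N)))"
proof -
  interpret right_module R M by fact
  have \<sigma>: "\<sigma> \<in> carrier R \<rightarrow> carrier R"
    using assms(2) by (simp add: ring_hom_def)
  have \<delta>: "\<delta> \<in> carrier R \<rightarrow> carrier R"
    using assms(3) by (simp add: sigma_derivation_def)
  show ?thesis
    unfolding completely_sigma_delta_compatible_def sigma_delta_compatible_def
    using \<sigma> \<delta> completely_sigma_compatible_imp_sigma_compatible
      completely_delta_compatible_imp_delta_compatible
      completely_sigma_compatible_quotient completely_delta_compatible_quotient
    by blast
qed

end
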